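(* Let $0<p<1$ and $0<\beta<\alpha\le1$. For every sequence $(a_n)_{n\ge1}$ of non-negative reals, $$\sum_{n=1}^{\infty}\left(\left(n^{\beta}-(n-1)^{\beta}\right)\sum_{k=n}^{\infty}k^{-\beta}a_k\right)^p\le\sum_{n=1}^{\infty}\left(\left(n^{\alpha}-(n-1)^{\alpha}\right)\sum_{k=n}^{\infty}k^{-\alpha}a_k\right)^p .$$ The constant is best possible, i.e. for each such $p,\alpha,\beta$ the constant $1$ multiplying the right-hand side cannot be replaced by any smaller constant for which the inequality holds for all non-negative sequences $(a_n)$.
   Context: All sums of non-negative terms are understood as elements of $[0,\infty]$, with $\infty^p=\infty$. *)

theory Defs
  imports "HOL-Analysis.Analysis"
begin

(* x^p on [0, infinity], meant for exponents p > 0 only: the value at infinity is infinity. *)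
definition ennreal_powr :: "ennreal \<Rightarrow> real \<Rightarrow> ennreal" where
  "ennreal_powr x p = (if x = \<infinity> then \<infinity> else ennreal (enn2real x powr p))"

(* Sequences are indexed by n >= 1; the value a 0 is never used. Every family in ennreal is
   summable, so both infinite sums are the genuine sums in [0, infinity]. For c > 0 the
   term n = 1 uses 0 powr c = 0. *)
definition tail_power_sum :: "real \<Rightarrow> real \<Rightarrow> (nat \<Rightarrow> real) \<Rightarrow> ennreal" where
  "tail_power_sum p c a =
     (\<Sum>\<^sub>\<infinity>n\<in>{1..}. ennreal_powr
        (ennreal (real n powr c - (real n - 1) powr c) *
          (\<Sum>\<^sub>\<infinity>k\<in>{n..}. ennreal (real k powr (- c) * a k))) p)"

end

theory Submission
  imports Defs
begin

text \<open>
  Put \<open>x\<^sub>n = (n\<^sup>\<alpha> - (n - 1)\<^sup>\<alpha>) \<Sum>\<^bsub>k\<ge>n\<^esub> k\<^sup>-\<^sup>\<alpha> a\<^sub>k\<close> and let \<open>y\<^sub>n\<close> be the same with \<open>\<beta>\<close> in place of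
  \<open>\<alpha>\<close>.  Each \<open>a\<^sub>k\<close> is spread over the indices \<open>1, \<dots>, k\<close> in such a way that the first \<open>N\<close> of
  them receive \<open>min(1, N/k)\<^sup>\<alpha> a\<^sub>k\<close>, respectively \<open>min(1, N/k)\<^sup>\<beta> a\<^sub>k\<close>.  So \<open>y\<close> has the larger
  partial sums while the total is \<open>\<Sum> a\<^sub>k\<close> for both; as \<open>x\<close> is nonincreasing, the inequality is
  Karamata's inequality for the concave function \<open>t\<^sup>p\<close>, applied to finitely supported \<open>a\<close> first.
  The unit sequence at \<open>n = 1\<close> gives equality.
\<close>

section \<open>Concavity of \<open>t powr p\<close> and Karamata's inequality\<close>

text \<open>Weighted AM-GM for \<open>y / x\<close> and \<open>1\<close> with weights
  \<open>p\<close> and \<open>1 - p\<close>, scaled by \<open>x powr p\<close>. The case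
  \<open>y = 0\<close> is separate because AM-GM is applied to positive numbers.\<close>

lemma powr_le_tangent:
  fixes x y p :: real
  assumes "0 < p" "p \<le> 1" "0 < x" "0 \<le> y"
  shows "y powr p \<le> x powr p + p * x powr (p - 1) * (y - x)"
proof (cases "y = 0")
  case True
  have "p * (x powr (p - 1) * x) = p * x powr p"
    using assms by (simp add: powr_diff)
  moreover have "p * x powr p \<le> x powr p"
    using assms by (simp add: mult_left_le_one_le)
  ultimately show ?thesis
    using True by (auto simp: mult.assoc simp del: mult_cancel_left)
next
  case False
  have "(y / x) powr p * 1 powr (1 - p) \<le> p * (y / x) + (1 - p) * 1"
    using assms False by (intro Youngs_inequality_0) auto
  hence "x powr p * (y / x) powr p \<le> x powr p * (p * (y / x) + (1 - p))"
    by (intro mult_left_mono) auto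
  moreover have "x powr p * (y / x) powr p = y powr p"
    using assms by (simp add: powr_divide)
  moreover have "x powr p * (p * (y / x) + (1 - p)) = x powr p + p * x powr (p - 1) * (y - x)"
    using assms by (simp add: powr_diff field_simps)
  ultimately show ?thesis by simp
qed

text \<open>Summation by parts as an induction: raising the weight from \<open>c M\<close> to
  \<open>c (Suc M)\<close> can only lower its product with the non-positive partial sum up to
  \<open>M\<close>.\<close>

lemma sum_mult_ge_Abel:
  fixes c d :: "nat \<Rightarrow> real"
  assumes "\<And>n. 1 \<le> n \<Longrightarrow> n < M \<Longrightarrow> c n \<le> c (Suc n)"
    and "\<And>N. N < M \<Longrightarrow> (\<Sum>n=1..N. d n) \<le> 0"
  shows "c M * (\<Sum>n=1..M. d n) \<le> (\<Sum>n=1..M. c n * d n)"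
  using assms
proof (induction M)
  case (Suc M)
  have "c (Suc M) * (\<Sum>n=1..M. d n) \<le> c M * (\<Sum>n=1..M. d n)"
  \<comment> \<open>Monotonicity of \<open>c\<close> starts at index 1 and does not reach
    \<open>c 0\<close>; for \<open>M = 0\<close> the sum is empty.\<close>
  proof (cases "M = 0")
    case False
    then show ?thesis
      using Suc.prems by (intro mult_right_mono_neg) auto
  qed simp
  also have "\<dots> \<le> (\<Sum>n=1..M. c n * d n)"
    using Suc by auto
  finally show ?case
    by (simp add: algebra_simps)
qed simp

text \<open>Tangents are taken at the points \<open>x n\<close>. Since \<open>x\<close> decreases
  and \<open>p - 1 \<le> 0\<close>, their slopes \<open>c n\<close> increase, so Abel summation
  bounds the weighted sum of \<open>x n - y n\<close> below by \<open>c M\<close> times the total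
  difference, which is 0.\<close>

lemma Karamata_powr:
  fixes x y :: "nat \<Rightarrow> real"
  assumes p: "0 < p" "p \<le> 1"
    and x: "\<And>n. 1 \<le> n \<Longrightarrow> n \<le> M \<Longrightarrow> 0 < x n"
    and y: "\<And>n. 1 \<le> n \<Longrightarrow> n \<le> M \<Longrightarrow> 0 \<le> y n"
    and decr: "\<And>n. 1 \<le> n \<Longrightarrow> n < M \<Longrightarrow> x (Suc n) \<le> x n"
    and major: "\<And>N. N < M \<Longrightarrow> (\<Sum>n=1..N. x n) \<le> (\<Sum>n=1..N. y n)"
    and total: "(\<Sum>n=1..M. x n) = (\<Sum>n=1..M. y n)"
  shows "(\<Sum>n=1..M. y n powr p) \<le> (\<Sum>n=1..M. x n powr p)"
proof -
  define c where "c n = p * x n powr (p - 1)" for n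
  have "c n \<le> c (Suc n)" if "1 \<le> n" "n < M" for n
    unfolding c_def using that p x decr by (intro mult_left_mono powr_mono2') auto
  hence "c M * (\<Sum>n=1..M. x n - y n) \<le> (\<Sum>n=1..M. c n * (x n - y n))"
    using major by (intro sum_mult_ge_Abel) (auto simp: sum_subtractf)
  hence "0 \<le> (\<Sum>n=1..M. c n * (x n - y n))"
    using total by (simp add: sum_subtractf)
  also have "\<dots> \<le> (\<Sum>n=1..M. x n powr p - y n powr p)"
  proof (rule sum_mono)
    fix n assume "n \<in> {1..M}"
    then have "y n powr p \<le> x n powr p + c n * (y n - x n)"
      unfolding c_def using p x y by (intro powr_le_tangent) auto
    then show "c n * (x n - y n) \<le> x n powr p - y n powr p"
      by (simp add: algebra_simps)
  qed
  finally show ?thesis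
    by (simp add: sum_subtractf)
qed

section \<open>Truncated sums and the finite inequality\<close>

definition powr_step :: "real \<Rightarrow> nat \<Rightarrow> real" where
  "powr_step c n = real n powr c - (real n - 1) powr c"

lemma powr_step_nonneg: "0 \<le> c \<Longrightarrow> 1 \<le> n \<Longrightarrow> 0 \<le> powr_step c n"
  unfolding powr_step_def by (simp add: powr_mono2)

lemma powr_step_pos: "0 < c \<Longrightarrow> 1 \<le> n \<Longrightarrow> 0 < powr_step c n"
  unfolding powr_step_def by (simp add: powr_less_mono2)

text \<open>Both steps are compared with the derivative of \<open>t powr c\<close> at \<open>t = n\<close>; the tangent bound is valid
  even at \<open>n - 1 = 0\<close>.\<close>

lemma powr_step_Suc_le:
  assumes "0 < c" "c \<le> 1" "1 \<le> n"
  shows "powr_step c (Suc n) \<le> powr_step c n"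
proof -
  have "real (Suc n) powr c \<le> real n powr c + c * real n powr (c - 1) * (real (Suc n) - real n)"
    using assms by (intro powr_le_tangent) auto
  moreover have "(real n - 1) powr c \<le> real n powr c + c * real n powr (c - 1) * (real n - 1 - real n)"
    using assms by (intro powr_le_tangent) auto
  ultimately show ?thesis
    unfolding powr_step_def by simp
qed

lemma sum_powr_step: "(\<Sum>n=1..N. powr_step c n) = real N powr c"
  by (induction N) (simp_all add: powr_step_def)

text \<open>Cutting the tail at \<open>M\<close> amounts to replacing \<open>a\<close> by 0 beyond
  \<open>M\<close>; the value is 0 for \<open>n > M\<close>.\<close>

definition tail_term :: "real \<Rightarrow> (nat \<Rightarrow> real) \<Rightarrow> nat \<Rightarrow> nat \<Rightarrow> real" where
  "tail_term c a M n = powr_step c n * (\<Sum>k=n..M. real k powr (- c) * a k)"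

lemma tail_term_nonneg:
  assumes "0 \<le> c" "\<forall>n\<ge>1. 0 \<le> a n" "1 \<le> n"
  shows "0 \<le> tail_term c a M n"
  unfolding tail_term_def using assms
  by (intro mult_nonneg_nonneg powr_step_nonneg sum_nonneg) auto

text \<open>After exchanging the sums, the steps with \<open>n \<le> min N k\<close> telescope.
  Writing the weight as a power of a ratio in [0,1] makes its dependence on \<open>c\<close>
  monotone.\<close>

lemma sum_tail_term:
  assumes "N \<le> M"
  shows "(\<Sum>n=1..N. tail_term c a M n)
       = (\<Sum>k=1..M. (real (min N k) / real k) powr c * a k)"
proof -
  have "(\<Sum>n=1..N. tail_term c a M n)
      = (\<Sum>n=1..N. \<Sum>k\<in>{k\<in>{1..M}. n \<le> k}. powr_step c n * (real k powr (- c) * a k))"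
    unfolding tail_term_def sum_distrib_left by (intro sum.cong) auto
  also have "\<dots> = (\<Sum>k=1..M. \<Sum>n\<in>{n\<in>{1..N}. n \<le> k}. powr_step c n * (real k powr (- c) * a k))"
    by (rule sum.swap_restrict) auto
  also have "\<dots> = (\<Sum>k=1..M. (real (min N k) / real k) powr c * a k)"
  proof (rule sum.cong)
    fix k assume k: "k \<in> {1..M}"
    have "{n\<in>{1..N}. n \<le> k} = {1..min N k}" by auto
    then have "(\<Sum>n\<in>{n\<in>{1..N}. n \<le> k}. powr_step c n * (real k powr (- c) * a k))
        = real (min N k) powr c * (real k powr (- c) * a k)"
      by (simp only: sum_distrib_right[symmetric] sum_powr_step)
    then show "(\<Sum>n\<in>{n\<in>{1..N}. n \<le> k}. powr_step c n * (real k powr (- c) * a k))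
        = (real (min N k) / real k) powr c * a k"
      by (simp add: powr_divide powr_minus_divide)
  qed simp
  finally show ?thesis .
qed

text \<open>The induction strips trailing zeros of \<open>a\<close>: once the last entry is
  positive, all tails are positive, as the tangents in Karamata's inequality require.\<close>

lemma tail_term_powr_sum_le:
  assumes p: "0 < p" "p \<le> 1" and \<beta>: "0 < \<beta>" "\<beta> \<le> \<alpha>" "\<alpha> \<le> 1" and a: "\<forall>n\<ge>1. 0 \<le> a n"
  shows "(\<Sum>n=1..M. tail_term \<beta> a M n powr p) \<le> (\<Sum>n=1..M. tail_term \<alpha> a M n powr p)"
proof (induction M)
  case (Suc M)
  show ?case
  proof (cases "a (Suc M) = 0")
    case True
    then have "tail_term c a (Suc M) n = tail_term c a M n" for c n
      by (simp add: tail_term_def)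
    moreover have "tail_term c a M (Suc M) = 0" for c
      by (simp add: tail_term_def)
    ultimately show ?thesis
      using Suc by simp
  next
    case False
    with a have aM: "0 < a (Suc M)"
      by (simp add: order_less_le)
    show ?thesis
    proof (rule Karamata_powr)
      fix n assume n: "1 \<le> n" "n \<le> Suc M"
      have "0 < (\<Sum>k=n..Suc M. real k powr (- \<alpha>) * a k)"
        by (rule sum_pos2[of _ "Suc M"]) (use n a aM in auto)
      then show "0 < tail_term \<alpha> a (Suc M) n"
        unfolding tail_term_def using n \<beta> by (intro mult_pos_pos powr_step_pos) auto
      show "0 \<le> tail_term \<beta> a (Suc M) n"
        using n \<beta> a by (intro tail_term_nonneg) auto
    next
      fix n assume n: "1 \<le> n" "n < Suc M"
      then show "tail_term \<alpha> a (Suc M) (Suc n) \<le> tail_term \<alpha> a (Suc M) n"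
        unfolding tail_term_def using \<beta> a
        by (intro mult_mono powr_step_Suc_le sum_mono2 powr_step_nonneg sum_nonneg) auto
    next
      fix N assume N: "N < Suc M"
      \<comment> \<open>The base lies in [0,1], so the smaller exponent gives the larger
        power.\<close>
      have "(real (min N k) / real k) powr \<alpha> \<le> (real (min N k) / real k) powr \<beta>"
        if "1 \<le> k" for k
        using that \<beta> by (cases "N = 0") (auto intro!: powr_mono')
      then show "(\<Sum>n=1..N. tail_term \<alpha> a (Suc M) n) \<le> (\<Sum>n=1..N. tail_term \<beta> a (Suc M) n)"
        unfolding sum_tail_term[OF less_imp_le[OF N]] using a
        by (intro sum_mono mult_right_mono) auto
    next
      \<comment> \<open>Here \<open>min (Suc M) k = k\<close>, so every ratio is 1 and the exponent
        disappears.\<close>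
      have "(\<Sum>n=1..Suc M. tail_term c a (Suc M) n) = (\<Sum>k=1..Suc M. a k)" for c
        unfolding sum_tail_term[OF order.refl] by (intro sum.cong) auto
      then show "(\<Sum>n=1..Suc M. tail_term \<alpha> a (Suc M) n) = (\<Sum>n=1..Suc M. tail_term \<beta> a (Suc M) n)"
        by simp
    qed (use p in auto)
  qed
qed simp

section \<open>Powers and infinite sums in [0, infinity]\<close>

lemma ennreal_powr_ennreal: "0 \<le> x \<Longrightarrow> ennreal_powr (ennreal x) p = ennreal (x powr p)"
  by (simp add: ennreal_powr_def)

lemma ennreal_powr_mono:
  assumes "0 \<le> p" "x \<le> y"
  shows "ennreal_powr x p \<le> ennreal_powr y p"
proof (cases "y = \<infinity>")
  case False
  then have "x < top" "y < top"
    using assms(2) by (auto simp: less_top top_unique)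
  then show ?thesis
    using assms by (auto simp: ennreal_powr_def intro!: ennreal_leI powr_mono2 enn2real_mono)
qed (simp add: ennreal_powr_def)

text \<open>Infinite limits matter because the inner tails may diverge. There the threshold
  \<open>(l + 1) powr (1 / p)\<close> works, its \<open>p\<close>-th power being
  \<open>l + 1 > l\<close>.\<close>

lemma tendsto_ennreal_powr:
  assumes "(f \<longlongrightarrow> x) F" "0 < p"
  shows "((\<lambda>i. ennreal_powr (f i) p) \<longlongrightarrow> ennreal_powr x p) F"
proof (cases x)
  case (real r)
  have "\<forall>\<^sub>F i in F. f i < top"
    using order_tendstoD(2)[OF assms(1)] real by simp
  then have ev: "\<forall>\<^sub>F i in F. ennreal_powr (f i) p = ennreal (enn2real (f i) powr p)"
    by eventually_elim (auto simp: ennreal_powr_def)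
  have "((\<lambda>i. ennreal (enn2real (f i) powr p)) \<longlongrightarrow> ennreal (r powr p)) F"
    using assms real by (intro tendsto_intros) auto
  then show ?thesis
    using real tendsto_cong[OF ev] by (simp add: ennreal_powr_ennreal)
next
  case top
  have "\<forall>\<^sub>F i in F. ennreal l < ennreal_powr (f i) p" if l: "0 \<le> l" for l
  proof -
    have "\<forall>\<^sub>F i in F. ennreal ((l + 1) powr (1 / p)) < f i"
      using assms(1) top by (simp add: tendsto_top_iff_ennreal)
    then show ?thesis
    proof eventually_elim
      case (elim i)
      have "ennreal l < ennreal (((l + 1) powr (1 / p)) powr p)"
        using l assms(2) by (simp add: powr_powr ennreal_less_iff)
      also have "\<dots> = ennreal_powr (ennreal ((l + 1) powr (1 / p))) p"
        by (simp add: ennreal_powr_ennreal)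
      also have "\<dots> \<le> ennreal_powr (f i) p"
        using elim assms(2) by (intro ennreal_powr_mono) auto
      finally show ?case .
    qed
  qed
  then show ?thesis
    using top by (simp add: tendsto_top_iff_ennreal ennreal_powr_def)
qed

lemma infsum_atLeast_ennreal:
  fixes f :: "nat \<Rightarrow> ennreal"
  shows "(\<Sum>\<^sub>\<infinity>k\<in>{n..}. f k) = (SUP M. \<Sum>k=n..M. f k)"
proof (rule antisym)
  show "(\<Sum>\<^sub>\<infinity>k\<in>{n..}. f k) \<le> (SUP M. \<Sum>k=n..M. f k)"
    unfolding nonneg_infsum_complete[of "{n..}" f, OF zero_le]
  proof (rule SUP_least)
    fix A assume A: "A \<in> {A. finite A \<and> A \<subseteq> {n..}}"
    \<comment> \<open>For empty \<open>A\<close> the value of \<open>Max A\<close> is unspecified,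
      but the inclusion is trivial.\<close>
    then have "A \<subseteq> {n..Max A}" by auto
    then have "sum f A \<le> (\<Sum>k=n..Max A. f k)"
      by (intro sum_mono2) auto
    then show "sum f A \<le> (SUP M. \<Sum>k=n..M. f k)"
      by (rule SUP_upper2[OF UNIV_I])
  qed
  show "(SUP M. \<Sum>k=n..M. f k) \<le> (\<Sum>\<^sub>\<infinity>k\<in>{n..}. f k)"
    unfolding nonneg_infsum_complete[of "{n..}" f, OF zero_le]
    by (intro SUP_least SUP_upper) auto
qed

lemma sum_tendsto_infsum_atLeast_ennreal:
  fixes f :: "nat \<Rightarrow> ennreal"
  shows "(\<lambda>M. \<Sum>k=n..M. f k) \<longlonglongrightarrow> (\<Sum>\<^sub>\<infinity>k\<in>{n..}. f k)"
  unfolding infsum_atLeast_ennreal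
  by (intro LIMSEQ_SUP incseq_SucI sum_mono2) auto

section \<open>Passage to infinite sequences\<close>

text \<open>The limit of \<open>tail_term\<close> as \<open>M\<close> grows. The step is spelled out
  so that the term agrees literally with the one inside \<open>tail_power_sum\<close>.\<close>

definition tail_limit :: "real \<Rightarrow> (nat \<Rightarrow> real) \<Rightarrow> nat \<Rightarrow> ennreal" where
  "tail_limit c a n = ennreal (real n powr c - (real n - 1) powr c) *
     (\<Sum>\<^sub>\<infinity>k\<in>{n..}. ennreal (real k powr (- c) * a k))"

lemma ennreal_tail_term:
  assumes "0 \<le> c" "\<forall>n\<ge>1. 0 \<le> a n" "1 \<le> n"
  shows "ennreal (tail_term c a M n)
       = ennreal (powr_step c n) * (\<Sum>k=n..M. ennreal (real k powr (- c) * a k))"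
proof -
  have "(\<Sum>k=n..M. ennreal (real k powr (- c) * a k)) = ennreal (\<Sum>k=n..M. real k powr (- c) * a k)"
    using assms by (intro sum_ennreal) auto
  then show ?thesis
    unfolding tail_term_def by (simp only: ennreal_mult'[OF powr_step_nonneg[OF assms(1,3)]])
qed

lemma tail_term_tendsto:
  assumes "0 \<le> c" "\<forall>n\<ge>1. 0 \<le> a n" "1 \<le> n"
  shows "(\<lambda>M. ennreal (tail_term c a M n)) \<longlonglongrightarrow> tail_limit c a n"
  unfolding ennreal_tail_term[OF assms] tail_limit_def powr_step_def
  by (rule ennreal_tendsto_cmult[OF ennreal_less_top sum_tendsto_infsum_atLeast_ennreal])

lemma tail_term_le:
  assumes "0 \<le> c" "\<forall>n\<ge>1. 0 \<le> a n" "1 \<le> n"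
  shows "ennreal (tail_term c a M n) \<le> tail_limit c a n"
  unfolding ennreal_tail_term[OF assms] tail_limit_def powr_step_def infsum_atLeast_ennreal
  by (rule mult_left_mono[OF SUP_upper[OF UNIV_I] zero_le])

lemma tail_power_sum_SUP:
  "tail_power_sum p c a = (SUP N. \<Sum>n=1..N. ennreal_powr (tail_limit c a n) p)"
  unfolding tail_power_sum_def infsum_atLeast_ennreal tail_limit_def by (rule refl)

text \<open>Two limits in succession: with the outer cutoff \<open>N\<close> fixed, the finite
  inequality is used for each \<open>M \<ge> N\<close> and \<open>M\<close> tends to infinity; only
  then is the supremum over \<open>N\<close> taken.\<close>

lemma tail_power_sum_le:
  assumes p: "0 < p" "p \<le> 1" and \<beta>: "0 < \<beta>" "\<beta> \<le> \<alpha>" "\<alpha> \<le> 1" and a: "\<forall>n\<ge>1. 0 \<le> a n"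
  shows "tail_power_sum p \<beta> a \<le> tail_power_sum p \<alpha> a"
  unfolding tail_power_sum_SUP[of p \<beta>]
proof (rule SUP_least)
  fix N
  have "(\<Sum>n=1..N. ennreal_powr (ennreal (tail_term \<beta> a M n)) p) \<le> tail_power_sum p \<alpha> a"
    if "N \<le> M" for M
  proof -
    have eq: "(\<Sum>n=1..M. ennreal_powr (ennreal (tail_term c a M n)) p)
        = ennreal (\<Sum>n=1..M. tail_term c a M n powr p)" if "0 < c" for c
      using tail_term_nonneg[of c a] that a
      by (subst sum_ennreal[symmetric]) (auto intro!: sum.cong simp: ennreal_powr_ennreal)
    have "(\<Sum>n=1..N. ennreal_powr (ennreal (tail_term \<beta> a M n)) p)
        \<le> (\<Sum>n=1..M. ennreal_powr (ennreal (tail_term \<beta> a M n)) p)"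
      using that by (intro sum_mono2) auto
    also have "\<dots> \<le> (\<Sum>n=1..M. ennreal_powr (ennreal (tail_term \<alpha> a M n)) p)"
      using \<beta> eq[of \<alpha>] eq[of \<beta>] ennreal_leI[OF tail_term_powr_sum_le[OF assms], of M]
      by (metis order_less_le_trans)
    also have "\<dots> \<le> (\<Sum>n=1..M. ennreal_powr (tail_limit \<alpha> a n) p)"
      using p \<beta> a by (intro sum_mono ennreal_powr_mono tail_term_le) auto
    also have "\<dots> \<le> tail_power_sum p \<alpha> a"
      unfolding tail_power_sum_SUP by (rule SUP_upper) simp
    finally show ?thesis .
  qed
  moreover have "(\<lambda>M. \<Sum>n=1..N. ennreal_powr (ennreal (tail_term \<beta> a M n)) p)
      \<longlonglongrightarrow> (\<Sum>n=1..N. ennreal_powr (tail_limit \<beta> a n) p)"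
    using p \<beta> a by (intro tendsto_sum tendsto_ennreal_powr tail_term_tendsto) auto
  ultimately show "(\<Sum>n=1..N. ennreal_powr (tail_limit \<beta> a n) p) \<le> tail_power_sum p \<alpha> a"
    by (intro LIMSEQ_le_const2) auto
qed

section \<open>Sharpness of the constant\<close>

text \<open>Tails from \<open>n \<ge> 2\<close> miss the only nonzero entry, and the step at
  \<open>n = 1\<close> is \<open>1 powr c - 0 powr c = 1\<close>. The value is thus the same for
  \<alpha> and \<beta>, which forces any admissible constant to be at least 1.\<close>

lemma tail_power_sum_unit:
  assumes "0 < c"
  shows "tail_power_sum p c (\<lambda>k. if k = 1 then 1 else 0) = 1"
proof -
  let ?a = "\<lambda>k::nat. if k = 1 then 1 else 0 :: real"
  have "(\<Sum>\<^sub>\<infinity>k\<in>{n..}. ennreal (real k powr (- c) * ?a k)) = (if n = 1 then 1 else 0)"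
    if "1 \<le> n" for n
  proof -
    have "(\<Sum>\<^sub>\<infinity>k\<in>{n..}. ennreal (real k powr (- c) * ?a k))
        = (\<Sum>\<^sub>\<infinity>k\<in>(if n = 1 then {1} else {}). ennreal (real k powr (- c) * ?a k))"
      using that by (intro infsum_cong_neutral) auto
    then show ?thesis by simp
  qed
  then have lim: "tail_limit c ?a n = (if n = 1 then 1 else 0)" if "1 \<le> n" for n
    using that by (simp add: tail_limit_def)
  have "tail_power_sum p c ?a = (\<Sum>\<^sub>\<infinity>n\<in>{1..}. ennreal_powr (tail_limit c ?a n) p)"
    unfolding tail_power_sum_def tail_limit_def by (rule refl)
  also have "\<dots> = (\<Sum>\<^sub>\<infinity>n\<in>{1}. ennreal_powr (tail_limit c ?a n) p)"
    by (intro infsum_cong_neutral) (auto simp: lim[unfolded One_nat_def] ennreal_powr_def)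
  also have "\<dots> = 1"
    by (simp add: lim[unfolded One_nat_def] ennreal_powr_def)
  finally show ?thesis .
qed

theorem theorem4p3:
  fixes p \<alpha> \<beta> :: real
  assumes "0 < p" "p < 1"
    and "0 < \<beta>" "\<beta> < \<alpha>" "\<alpha> \<le> 1"
  shows "(\<forall>a :: nat \<Rightarrow> real. (\<forall>n\<ge>1. 0 \<le> a n) \<longrightarrow>
            tail_power_sum p \<beta> a \<le> tail_power_sum p \<alpha> a) \<and>
         (\<forall>C :: ennreal. C < 1 \<longrightarrow>
            \<not> (\<forall>a :: nat \<Rightarrow> real. (\<forall>n\<ge>1. 0 \<le> a n) \<longrightarrow>
                 tail_power_sum p \<beta> a \<le> C * tail_power_sum p \<alpha> a))"
proof (intro conjI allI impI)
  fix a :: "nat \<Rightarrow> real" assume "\<forall>n\<ge>1. 0 \<le> a n"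
  then show "tail_power_sum p \<beta> a \<le> tail_power_sum p \<alpha> a"
    using assms by (intro tail_power_sum_le) auto
next
  fix C :: ennreal assume C: "C < 1"
  show "\<not> (\<forall>a :: nat \<Rightarrow> real. (\<forall>n\<ge>1. 0 \<le> a n) \<longrightarrow>
                 tail_power_sum p \<beta> a \<le> C * tail_power_sum p \<alpha> a)"
  proof
    assume "\<forall>a :: nat \<Rightarrow> real. (\<forall>n\<ge>1. 0 \<le> a n) \<longrightarrow>
                 tail_power_sum p \<beta> a \<le> C * tail_power_sum p \<alpha> a"
    from this[rule_format, of "\<lambda>k. if k = 1 then 1 else 0"] have "1 \<le> C"
      using assms by (simp only: tail_power_sum_unit) simp
    with C show False by simp
  qed
qed

end
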